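(* For $\sigma>0$ and $\xi\in[0,1)$ let $\mu_{(\sigma,\xi)}$ be the generalized Pareto distribution with density $f_{\xi,\sigma}(y)=\sigma^{-1}(1+\xi y/\sigma)^{-1/\xi-1}$, $y>0$ (for $\xi=0$, the exponential density $\sigma^{-1}e^{-y/\sigma}$). Take as base measure $\mu_b=\delta_0$, corresponding to $\sigma=0$. Then the bivariate $\mathrm{WCP}_1$ prior for $(\sigma,\xi)$ with hyperparameter $\eta>0$ has density $$\pi_{\sigma,\xi}(\sigma,\xi)=\frac{\eta}{1-\xi}\exp\left(-\eta\,\frac{\sigma}{1-\xi}\right),\qquad \sigma>0,\ \xi\in[0,1).$$
   Context: $W_1$ is the Wasserstein-1 distance between probability measures on $\mathbb R$: $W_1(\mu,\nu)=\inf$ over couplings $(X,Y)$ of $\mu$ and $\nu$ of $\mathbb E|X-Y|$. Multivariate $\mathrm{WCP}_p$ prior (here $d=2$, $p=1$, $\boldsymbol\theta=(\sigma,\xi)$). Let $\boldsymbol\Theta\subset\mathbb R^d$ be the parameter set, $\mu_b$ the base measure, $W_p(\boldsymbol\theta)=W_p(\mu_b,\mu_{\boldsymbol\theta})$, $c=\sup_{\boldsymbol\theta\in\boldsymbol\Theta}W_p(\boldsymbol\theta)\in(0,\infty]$, and $S_{w,\boldsymbol\theta}=\{\boldsymbol\theta:W_p(\boldsymbol\theta)=w\}$ the level sets (endpoints of the level curves have zero length and are irrelevant). The $\mathrm{WCP}_p$ prior with hyperparameter $\eta>0$ is the law of $\boldsymbol\theta$ for which $w=W_p(\boldsymbol\theta)$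 has an exponential distribution with rate $\eta$ truncated to $(0,c)$ and, given $w$, $\boldsymbol\theta$ is uniformly distributed on $S_{w,\boldsymbol\theta}$ with respect to $(d-1)$-dimensional surface area (arc length for $d=2$). Explicitly: if for every $w>0$ with $S_{w,\boldsymbol\theta}\ne\emptyset$ there is a parameterization $X_w:U_w\subset\mathbb R^{d-1}\to\widetilde S_{w,\boldsymbol\theta}\subset S_{w,\boldsymbol\theta}$ with $\mathrm{Area}_{d-1}(S_{w,\boldsymbol\theta}\setminus\widetilde S_{w,\boldsymbol\theta})=0$, and $(w,\boldsymbol u)\mapsto X_w(\boldsymbol u)$ is a local diffeomorphism, its density is $$\pi(\boldsymbol\theta)=|\det J_{\boldsymbol\Phi}(\boldsymbol\theta)|\,\frac{\eta\exp(-\eta W_p(\boldsymbol\theta))}{1-\exp(-\eta c)}\,\frac{\sqrt{\det\boldsymbol G(\boldsymbol\theta)}}{\mathrm{Area}_{d-1}(S_{W_p(\boldsymbol\theta),\boldsymbol\theta})},$$ where $\boldsymbol\Phi(\boldsymbol\theta)=(W_p(\boldsymbol\theta),X_{W_p(\boldsymbol\theta)}^{-1}(\boldsymbol\theta))$, $J$ denotes Jacobian matrix, $\boldsymbol G(\boldsymbol\theta)=J_{X_w}(\boldsymbol u)^\top J_{X_w}(\boldsymbol u)$ evaluated at $w=W_p(\boldsymbol\theta)$, $\boldsymbol u=X_{W_p(\boldsymbol\theta)}^{-1}(\boldsymbol\theta)$, and $\exp(-\infty)=0$. The density is understood up to Lebesgue-null sets. *)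

theory Defs
  imports "HOL-Probability.Probability"
begin

definition couplings :: "real measure \<Rightarrow> real measure \<Rightarrow> (real \<times> real) measure set" where
  "couplings \<mu> \<nu> = {Q. prob_space Q \<and> sets Q = sets (borel \<Otimes>\<^sub>M borel) \<and>
     distr Q borel fst = \<mu> \<and> distr Q borel snd = \<nu>}"

definition wasserstein1 :: "real measure \<Rightarrow> real measure \<Rightarrow> ennreal" where
  "wasserstein1 \<mu> \<nu> = (INF Q\<in>couplings \<mu> \<nu>. \<integral>\<^sup>+ z. ennreal \<bar>fst z - snd z\<bar> \<partial>Q)"

(* Arc length of a set is its one-dimensional Hausdorff (outer) measure. It is defined for arbitrary
   sets, needs no parameterization, and agrees with the integral of the speed of any injective
   C1 parameterization. Boundedness is required because the library's diameter is
   unspecified on unbounded sets. *)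
definition hausdorff1_pre :: "real \<Rightarrow> 'a::metric_space set \<Rightarrow> ennreal" where
  "hausdorff1_pre \<delta> A =
     (INF C\<in>{C :: nat \<Rightarrow> 'a set. A \<subseteq> (\<Union>i. C i) \<and> (\<forall>i. bounded (C i) \<and> diameter (C i) \<le> \<delta>)}.
        \<Sum>i. ennreal (diameter (C i)))"

definition arc_length :: "'a::metric_space set \<Rightarrow> ennreal" where
  "arc_length A = (SUP \<delta>\<in>{0<..}. hausdorff1_pre \<delta> A)"

definition uniform_on_curve :: "'a::metric_space set \<Rightarrow> 'a measure \<Rightarrow> bool" where
  "uniform_on_curve S Q \<longleftrightarrow> prob_space Q \<and> 0 < arc_length S \<and> arc_length S < \<infinity> \<and>
     (\<forall>A\<in>sets Q. emeasure Q A = arc_length (A \<inter> S) / arc_length S)"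

(* exponential distribution with rate \<eta> truncated to (0, c), where c may be infinite *)
definition trunc_exp_density :: "real \<Rightarrow> ennreal \<Rightarrow> real \<Rightarrow> real" where
  "trunc_exp_density \<eta> c w =
     (if 0 < w \<and> ennreal w < c
      then \<eta> * exp (- \<eta> * w) / (1 - (if c = \<infinity> then 0 else exp (- \<eta> * enn2real c)))
      else 0)"

definition trunc_exp :: "real \<Rightarrow> ennreal \<Rightarrow> real measure" where
  "trunc_exp \<eta> c = density lborel (\<lambda>w. ennreal (trunc_exp_density \<eta> c w))"

(* P is the bivariate WCP_1 prior on \<Theta>, for the base measure \<mu>b, the family \<mu> and the
   hyperparameter \<eta>: W has the truncated exponential distribution, and K is a regular conditional
   distribution of the parameter given W, equal to the uniform distribution on the level set.
   The real-valued W agrees with the extended-real distance wherever the latter is finite; the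
   value 0 assigned where it is infinite has probability 0 under trunc_exp. *)
definition is_WCP1_prior ::
  "(real \<times> real) set \<Rightarrow> real measure \<Rightarrow> (real \<times> real \<Rightarrow> real measure) \<Rightarrow> real
     \<Rightarrow> (real \<times> real) measure \<Rightarrow> bool" where
  "is_WCP1_prior \<Theta> \<mu>b \<mu> \<eta> P \<longleftrightarrow>
     (let W = (\<lambda>\<theta>. enn2real (wasserstein1 \<mu>b (\<mu> \<theta>)));
          c = (SUP \<theta>\<in>\<Theta>. wasserstein1 \<mu>b (\<mu> \<theta>));
          S = (\<lambda>w. {\<theta>\<in>\<Theta>. wasserstein1 \<mu>b (\<mu> \<theta>) = ennreal w})
      in prob_space P \<and> sets P = sets (restrict_space borel \<Theta>) \<and>
         W \<in> borel_measurable P \<and> distr P borel W = trunc_exp \<eta> c \<and>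
         (\<exists>K \<in> borel \<rightarrow>\<^sub>M prob_algebra (restrict_space borel \<Theta>).
            (AE w in trunc_exp \<eta> c. uniform_on_curve (S w) (K w)) \<and>
            (\<forall>A\<in>sets P. \<forall>B\<in>sets borel.
               emeasure P {\<theta>\<in>A. W \<theta> \<in> B}
                 = (\<integral>\<^sup>+ w. emeasure (K w) A * indicator B w \<partial>trunc_exp \<eta> c))))"

definition gpd_density :: "real \<Rightarrow> real \<Rightarrow> real \<Rightarrow> real" where
  "gpd_density \<sigma> \<xi> y =
     (if 0 < y
      then (if \<xi> = 0 then exp (- y / \<sigma>) / \<sigma> else (1 + \<xi> * y / \<sigma>) powr (- 1 / \<xi> - 1) / \<sigma>)
      else 0)"

definition gpd :: "real \<times> real \<Rightarrow> real measure" where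
  "gpd = (\<lambda>(\<sigma>, \<xi>). density lborel (\<lambda>y. ennreal (gpd_density \<sigma> \<xi> y)))"

definition gpd_params :: "(real \<times> real) set" where
  "gpd_params = {0<..} \<times> {0..<1}"

end

theory Submission
  imports Defs "HOL-Real_Asymp.Real_Asymp"
begin

text \<open>
  The only coupling with a Dirac mass at 0 is the product, so the Wasserstein distance is the mean
  \<open>\<sigma> / (1 - \<xi>)\<close> of the generalized Pareto distribution. Its level set at \<open>w\<close> is the half-open segment
  from \<open>(w, 0)\<close> to \<open>(0, 1)\<close>, on which \<open>\<xi>\<close> is an affine parameter; hence the uniform distribution on
  the level set is the image of the uniform distribution on \<open>[0, 1)\<close> under \<open>\<xi> \<mapsto> (w (1 - \<xi>), \<xi>)\<close>.
  The distance is unbounded, so \<open>w\<close> is exponential without truncation, and the substitution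
  \<open>\<sigma> = w (1 - \<xi>)\<close> at fixed \<open>\<xi>\<close> contributes the factor \<open>1 / (1 - \<xi>)\<close> of the joint density.
\<close>

section \<open>One-dimensional Hausdorff measure of images of the line under similarities\<close>

text \<open>Preimages of covering sets need not be measurable, so they are replaced by Borel sets of
  no larger diameter: the closed interval between infimum and supremum serves.\<close>

lemma emeasure_real_le_diameter:
  fixes E :: "real set"
  assumes E: "\<And>x y. x \<in> E \<Longrightarrow> y \<in> E \<Longrightarrow> \<bar>x - y\<bar> \<le> r"
  obtains I where "I \<in> sets borel" "E \<subseteq> I" "emeasure lborel I \<le> ennreal r"
proof (cases "E = {}")
  case True
  then show ?thesis using that[of "{}"] by simp
next
  case False
  then obtain z where z: "z \<in> E" by auto
  have "E \<subseteq> {z - r..z + r}" using E[OF z] by (auto simp: abs_le_iff) (smt (verit))+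
  hence bdd: "bdd_above E" "bdd_below E" 
    by (auto intro: bdd_above_mono bdd_below_mono)
  have "Sup E \<le> Inf E + r"
  proof (rule cSup_least[OF False])
    fix x assume x: "x \<in> E"
    have "x - r \<le> Inf E"
      using E[OF x] by (intro cInf_greatest[OF False]) (smt (verit))
    thus "x \<le> Inf E + r" by simp
  qed
  moreover have "Inf E \<le> Sup E" using bdd z by (meson cInf_lower cSup_upper order_trans)
  ultimately have "emeasure lborel {Inf E..Sup E} \<le> ennreal r"
    by (simp add: ennreal_leI)
  moreover have "E \<subseteq> {Inf E..Sup E}" using bdd by (auto intro: cInf_lower cSup_upper)
  ultimately show ?thesis using that by (meson borel_closed closed_atLeastAtMost)
qed

text \<open>A cover of the image pulls back along \<open>f\<close> to a cover of \<open>B\<close> by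
  sets with diameters divided by \<open>L\<close>; countable subadditivity of Lebesgue measure
  bounds \<open>B\<close>. The bound is the same for every \<delta>.\<close>

lemma hausdorff1_pre_similarity_ge:
  fixes f :: "real \<Rightarrow> 'a::real_normed_vector"
  assumes f: "\<And>x y. dist (f x) (f y) = L * \<bar>x - y\<bar>" and L: "L > 0"
    and B: "B \<in> sets borel"
  shows "ennreal L * emeasure lborel B \<le> hausdorff1_pre \<delta> (f ` B)"
  unfolding hausdorff1_pre_def
proof (rule INF_greatest, clarify)
  fix C :: "nat \<Rightarrow> 'a set"
  assume cov: "f ` B \<subseteq> (\<Union>i. C i)" and C: "\<forall>i. bounded (C i) \<and> diameter (C i) \<le> \<delta>"
  have "\<exists>I. I \<in> sets borel \<and> f -` C i \<subseteq> I \<and> emeasure lborel I \<le> ennreal (diameter (C i) / L)" for i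
  proof -
    have "\<bar>x - y\<bar> \<le> diameter (C i) / L" if "x \<in> f -` C i" "y \<in> f -` C i" for x y
      using diameter_bounded_bound[of "C i" "f x" "f y"] that C L by (auto simp: f field_simps)
    from emeasure_real_le_diameter[OF this] show ?thesis by (metis (no_types, lifting))
  qed
  then obtain I where I: "\<And>i. I i \<in> sets borel" "\<And>i. f -` C i \<subseteq> I i"
    "\<And>i. emeasure lborel (I i) \<le> ennreal (diameter (C i) / L)" by metis
  have "B \<subseteq> (\<Union>i. f -` C i)" using cov by blast
  then have "B \<subseteq> (\<Union>i. I i)" using I(2) by blast
  then have "emeasure lborel B \<le> emeasure lborel (\<Union>i. I i)"
    using I(1) by (intro emeasure_mono) auto
  also have "\<dots> \<le> (\<Sum>i. emeasure lborel (I i))"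
    using I(1) by (intro emeasure_subadditive_countably) auto
  also have "\<dots> \<le> (\<Sum>i. ennreal (diameter (C i) / L))"
    using I(3) by (intro suminf_le) auto
  finally have "ennreal L * emeasure lborel B \<le> ennreal L * (\<Sum>i. ennreal (diameter (C i) / L))"
    by (rule mult_left_mono) simp
  also have "\<dots> = (\<Sum>i. ennreal (diameter (C i)))"
    using L C by (simp add: diameter_ge_0 flip: ennreal_suminf_cmult ennreal_mult)
  finally show "ennreal L * emeasure lborel B \<le> (\<Sum>i. ennreal (diameter (C i)))" .
qed

text \<open>An open superset \<open>U\<close> of \<open>B\<close> has almost the same measure, and
  \<open>B\<close> is covered by short nonoverlapping intervals inside \<open>U\<close>. Their
  images have diameter at most \<open>L\<close> times their length, so the sum of diameters is at
  most \<open>L\<close> times the measure of \<open>U\<close>.\<close>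

lemma hausdorff1_pre_similarity_le:
  fixes f :: "real \<Rightarrow> 'a::real_normed_vector"
  assumes f: "\<And>x y. dist (f x) (f y) = L * \<bar>x - y\<bar>" and L: "L > 0"
    and B: "B \<in> sets borel" "B \<subseteq> {a..b}" and "a < b" and \<delta>: "\<delta> > 0"
  shows "hausdorff1_pre \<delta> (f ` B) \<le> ennreal L * emeasure lborel B"
proof -
  have bound: "hausdorff1_pre \<delta> (f ` B) \<le> ennreal L * (emeasure lborel B + ennreal e)" if e: "e > 0" for e :: real
  proof -
    obtain U where U: "open U" "B \<subseteq> U" "emeasure lborel (U - B) < ennreal e"
      using outer_regular_lborel[OF B(1) e] by metis
    \<comment> \<open>The gauge forces the covering intervals into \<open>U\<close> and makes their images shorter than \<open>\<delta>\<close>.\<close>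
    define g where "g x = (if x \<in> U then U \<inter> ball x (\<delta> / (2 * L)) else ball x (\<delta> / (2 * L)))" for x
    have "gauge g" using U(1) L \<delta> by (auto simp: gauge_def g_def)
    have ab: "B \<subseteq> cbox a b" "box a b \<noteq> {}" using B \<open>a < b\<close> by (simp_all add: box_real)
    obtain D where D: "countable D"
      "\<And>K. K \<in> D \<Longrightarrow> interior K \<noteq> {} \<and> (\<exists>c d. K = cbox c d)"
      "pairwise (\<lambda>A B. interior A \<inter> interior B = {}) D"
      "\<And>K. K \<in> D \<Longrightarrow> \<exists>x \<in> B \<inter> K. K \<subseteq> g x" "B \<subseteq> \<Union>D"
      by (rule covering_lemma[OF ab \<open>gauge g\<close>]) blast
    define K where "K i = (if i \<in> to_nat_on D ` D then from_nat_into D i else {})" for i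
    have K_cases: "K i \<in> D \<or> K i = {}" for i
      using D(1) by (auto simp: K_def)
    have K_UN: "(\<Union>i. K i) = \<Union>D"
    proof -
      have "\<exists>i. K i = X" if "X \<in> D" for X
        using that D(1) by (intro exI[of _ "to_nat_on D X"]) (simp add: K_def)
      thus ?thesis using K_cases by (auto, metis empty_iff, metis)
    qed
    \<comment> \<open>Neighbouring intervals may share endpoints, so lengths are summed over
      interiors, which have the same measure.\<close>
    have disj: "disjoint_family (\<lambda>i. interior (K i))"
      unfolding disjoint_family_on_def
    proof (intro ballI impI)
      fix i j :: nat assume "i \<noteq> j"
      hence "K i = {} \<or> K j = {} \<or> (K i \<in> D \<and> K j \<in> D \<and> K i \<noteq> K j)"
        using D(1) by (auto simp: K_def)
      thus "interior (K i) \<inter> interior (K j) = {}" using D(3) by (auto simp: pairwise_def)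
    qed
    have K: "bounded (f ` K i) \<and> diameter (f ` K i) \<le> \<delta> \<and> K i \<subseteq> U \<and>
       ennreal (diameter (f ` K i)) \<le> ennreal L * emeasure lborel (interior (K i))" for i
    proof (cases "K i = {}")
      case True
      thus ?thesis using \<delta> by simp
    next
      case False
      hence KD: "K i \<in> D" using K_cases by auto
      then obtain c d where cd: "K i = {c..d}" "c < d"
        using D(2)[OF KD] by (auto simp: cbox_interval)
      obtain x where x: "x \<in> B" "K i \<subseteq> g x" using D(4)[OF KD] by auto
      hence sub: "K i \<subseteq> U" "K i \<subseteq> ball x (\<delta> / (2 * L))" using U(2) by (auto simp: g_def split: if_splits)
      \<comment> \<open>Both endpoints lie in one ball of radius \<open>\<delta> / (2 * L)\<close>,
        so the interval is shorter than \<open>\<delta> / L\<close>.\<close>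
      have "c \<in> ball x (\<delta> / (2 * L))" "d \<in> ball x (\<delta> / (2 * L))"
        using sub(2) unfolding cd(1) by (rule subsetD, simp add: less_imp_le cd(2))+
      hence "d - c < \<delta> / (2 * L) + \<delta> / (2 * L)" by (simp add: dist_real_def)
      hence "L * (d - c) \<le> \<delta>" using L by (simp add: field_simps)
      moreover have dist: "dist (f u) (f v) \<le> L * (d - c)" if "u \<in> K i" "v \<in> K i" for u v
        using that cd L by (auto simp: f intro!: mult_left_mono)
      hence "diameter (f ` K i) \<le> L * (d - c)"
        using False by (intro diameter_le) (auto simp: dist_norm)
      moreover have "bounded (f ` K i)"
        using dist cd(2) unfolding bounded_any_center[where a="f c"] cd(1) by (intro exI[of _ "L * (d - c)"]) auto
      moreover have "ennreal (L * (d - c)) = ennreal L * emeasure lborel (interior (K i))"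
        using cd L by (simp add: interior_atLeastAtMost_real ennreal_mult)
      ultimately show ?thesis using sub(1) by (auto intro: ennreal_leI order_trans)
    qed
    have "hausdorff1_pre \<delta> (f ` B) \<le> (\<Sum>i. ennreal (diameter (f ` K i)))"
      unfolding hausdorff1_pre_def
      by (rule INF_lower) (use K K_UN D(5) in \<open>auto simp flip: image_UN\<close>)
    also have "\<dots> \<le> (\<Sum>i. ennreal L * emeasure lborel (interior (K i)))"
      using K by (intro suminf_le) auto
    also have "\<dots> = ennreal L * emeasure lborel (\<Union>i. interior (K i))"
      using disj by (simp add: suminf_emeasure image_subset_iff)
    also have "\<dots> \<le> ennreal L * emeasure lborel U"
      using K interior_subset U(1) by (intro mult_left_mono emeasure_mono) fastforce+
    also have "emeasure lborel U = emeasure lborel B + emeasure lborel (U - B)"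
      using U B(1) by (subst plus_emeasure) (auto intro: arg_cong2[where f=emeasure])
    also have "ennreal L * \<dots> \<le> ennreal L * (emeasure lborel B + ennreal e)"
      using U(3) by (intro mult_left_mono add_left_mono) auto
    finally show ?thesis .
  qed
  show ?thesis
  proof (rule ennreal_le_epsilon)
    fix e :: real assume "e > 0"
    have "hausdorff1_pre \<delta> (f ` B) \<le> ennreal L * (emeasure lborel B + ennreal (e / L))"
      using L \<open>e > 0\<close> by (intro bound) auto
    also have "\<dots> = ennreal L * emeasure lborel B + ennreal e"
      using L \<open>e > 0\<close> by (simp add: distrib_left flip: ennreal_mult)
    finally show "hausdorff1_pre \<delta> (f ` B) \<le> ennreal L * emeasure lborel B + ennreal e" .
  qed
qed

lemma arc_length_similarity:
  fixes f :: "real \<Rightarrow> 'a::real_normed_vector"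
  assumes f: "\<And>x y. dist (f x) (f y) = L * \<bar>x - y\<bar>" and L: "L > 0"
    and B: "B \<in> sets borel" "B \<subseteq> {a..b}" and ab: "a < b"
  shows "arc_length (f ` B) = ennreal L * emeasure lborel B"
  unfolding arc_length_def
proof (rule antisym)
  show "(SUP \<delta>\<in>{0<..}. hausdorff1_pre \<delta> (f ` B)) \<le> ennreal L * emeasure lborel B"
    using hausdorff1_pre_similarity_le[OF f L B ab] by (intro SUP_least) auto
  show "ennreal L * emeasure lborel B \<le> (SUP \<delta>\<in>{0<..}. hausdorff1_pre \<delta> (f ` B))"
    using hausdorff1_pre_similarity_ge[OF f L B(1)] by (intro SUP_upper2[of 1]) auto
qed

section \<open>Total mass and mean of the generalized Pareto distribution\<close>

lemma gpd_density_measurable[measurable]: "gpd_density \<sigma> \<xi> \<in> borel_measurable borel"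
  unfolding gpd_density_def[abs_def] by measurable

text \<open>The antiderivative is minus the survival function, which is 1 at 0 and vanishes at
  infinity.\<close>

lemma gpd_total:
  assumes "\<sigma> > 0" "0 \<le> \<xi>" "\<xi> < 1"
  shows "(\<integral>\<^sup>+y. ennreal (gpd_density \<sigma> \<xi> y) \<partial>lborel) = 1"
proof (cases "\<xi> = 0")
  case True
  have "(\<integral>\<^sup>+y. ennreal (gpd_density \<sigma> \<xi> y) \<partial>lborel) =
     (\<integral>\<^sup>+y. ennreal (exp (- y / \<sigma>) / \<sigma>) * indicator {0..} y \<partial>lborel)"
    \<comment> \<open>The density is set to 0 at the origin but the closed formula is not, hence
      equality only off that point.\<close>
    by (rule nn_integral_cong_AE, use AE_lborel_singleton[of 0] in eventually_elim)
       (auto simp: gpd_density_def True split: split_indicator)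
  also have "\<dots> = ennreal (0 - (- exp (- 0 / \<sigma>)))"
    by (rule nn_integral_FTC_atLeast) (use assms in \<open>auto intro!: derivative_eq_intros, real_asymp\<close>)
  finally show ?thesis by simp
next
  case False
  with assms have xi: "\<xi> > 0" by simp
  have pos: "1 + \<xi> * y / \<sigma> > 0" if "y \<ge> 0" for y 
    using that assms xi by (simp add: add_pos_nonneg)
  have "(\<integral>\<^sup>+y. ennreal (gpd_density \<sigma> \<xi> y) \<partial>lborel) =
     (\<integral>\<^sup>+y. ennreal ((1 + \<xi> * y / \<sigma>) powr (- 1 / \<xi> - 1) / \<sigma>) * indicator {0..} y \<partial>lborel)"
    by (rule nn_integral_cong_AE, use AE_lborel_singleton[of 0] in eventually_elim)
       (auto simp: gpd_density_def False split: split_indicator)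
  also have "\<dots> = ennreal (0 - (- ((1 + \<xi> * 0 / \<sigma>) powr (- 1 / \<xi>))))"
  proof (rule nn_integral_FTC_atLeast)
    show "((\<lambda>y. - ((1 + \<xi> * y / \<sigma>) powr (- 1 / \<xi>))) \<longlongrightarrow> 0) at_top"
      using assms xi by real_asymp
    show "((\<lambda>y. - ((1 + \<xi> * y / \<sigma>) powr (- 1 / \<xi>))) has_real_derivative
        (1 + \<xi> * x / \<sigma>) powr (- 1 / \<xi> - 1) / \<sigma>) (at x)" if "0 \<le> x" for x
      using pos[OF that] xi assms
      by (auto intro!: derivative_eq_intros simp: powr_diff)
  qed (use assms in auto)
  finally show ?thesis by simp
qed

text \<open>Integration by parts: with survival function \<open>S\<close>, an antiderivative of
  \<open>y\<close> times the density is \<open>- y * S y\<close> minus the integral of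
  \<open>S\<close> over \<open>{y..}\<close>. Its value at 0 is minus the mean. Both cases use this
  antiderivative in closed form.\<close>

lemma gpd_mean:
  assumes "\<sigma> > 0" "0 \<le> \<xi>" "\<xi> < 1"
  shows "(\<integral>\<^sup>+y. ennreal (gpd_density \<sigma> \<xi> y) * ennreal \<bar>y\<bar> \<partial>lborel) = ennreal (\<sigma> / (1 - \<xi>))"
proof (cases "\<xi> = 0")
  case True
  have "(\<integral>\<^sup>+y. ennreal (gpd_density \<sigma> \<xi> y) * ennreal \<bar>y\<bar> \<partial>lborel) =
     (\<integral>\<^sup>+y. ennreal (y * exp (- y / \<sigma>) / \<sigma>) * indicator {0..} y \<partial>lborel)"
    by (rule nn_integral_cong)
       (use assms in \<open>auto simp: gpd_density_def True mult.commute ennreal_mult'[symmetric] split: split_indicator\<close>)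
  also have "\<dots> = ennreal (0 - (- (0 + \<sigma>) * exp (- 0 / \<sigma>)))"
  proof (rule nn_integral_FTC_atLeast)
    show "((\<lambda>y. - (y + \<sigma>) * exp (- y / \<sigma>)) has_real_derivative x * exp (- x / \<sigma>) / \<sigma>) (at x)" for x
      using assms by (auto intro!: derivative_eq_intros simp: field_simps)
    show "((\<lambda>y. - (y + \<sigma>) * exp (- y / \<sigma>)) \<longlongrightarrow> 0) at_top"
      using assms by real_asymp
  qed (use assms in auto)
  finally show ?thesis using True by simp
next
  case False
  with assms have xi: "\<xi> > 0" by simp
  have pos: "1 + \<xi> * y / \<sigma> > 0" if "y \<ge> 0" for y 
    using that assms xi by (simp add: add_pos_nonneg)
  define F where "F y = - y * (1 + \<xi> * y / \<sigma>) powr (- 1 / \<xi>) -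
    \<sigma> / (1 - \<xi>) * (1 + \<xi> * y / \<sigma>) powr (1 - 1 / \<xi>)" for y
  have "(\<integral>\<^sup>+y. ennreal (gpd_density \<sigma> \<xi> y) * ennreal \<bar>y\<bar> \<partial>lborel) =
     (\<integral>\<^sup>+y. ennreal (y * ((1 + \<xi> * y / \<sigma>) powr (- 1 / \<xi> - 1) / \<sigma>)) * indicator {0..} y \<partial>lborel)"
    by (rule nn_integral_cong)
       (use assms in \<open>auto simp: gpd_density_def False mult.commute ennreal_mult'[symmetric] split: split_indicator\<close>)
  also have "\<dots> = ennreal (0 - F 0)"
  proof (rule nn_integral_FTC_atLeast)
    \<comment> \<open>This makes the exponent \<open>1 - 1 / \<xi>\<close> negative, so the tail
      integral in \<open>F\<close> tends to 0; it is where \<open>\<xi> < 1\<close> guarantees a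
      finite mean.\<close>
    have "1 / \<xi> > 1" using xi assms by simp
    then show "(F \<longlongrightarrow> 0) at_top"
      unfolding F_def using assms xi by real_asymp
    show "(F has_real_derivative x * ((1 + \<xi> * x / \<sigma>) powr (- 1 / \<xi> - 1) / \<sigma>)) (at x)" if "0 \<le> x" for x
    proof -
      let ?u = "1 + \<xi> * x / \<sigma>" and ?k = "\<sigma> / (1 - \<xi>)"
      have deriv: "((\<lambda>y. (1 + \<xi> * y / \<sigma>) powr r) has_real_derivative r * ?u powr (r - 1) * (\<xi> / \<sigma>)) (at x)" for r
        by (rule DERIV_cong[OF DERIV_powr[where g = "\<lambda>y. 1 + \<xi> * y / \<sigma>" and m = "\<xi> / \<sigma>" and f = "\<lambda>_. r" and r = 0]])
           (use pos[OF that] assms(1) in \<open>auto intro!: derivative_eq_intros simp: powr_diff mult_ac\<close>)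
      have "(F has_real_derivative
          - (?u powr (- 1 / \<xi>)) - x * (- 1 / \<xi> * ?u powr (- 1 / \<xi> - 1) * (\<xi> / \<sigma>))
          - ?k * ((1 - 1 / \<xi>) * ?u powr (1 - 1 / \<xi> - 1) * (\<xi> / \<sigma>))) (at x)"
        unfolding F_def
        by (rule DERIV_cong[OF DERIV_diff[OF DERIV_mult[OF DERIV_minus[OF DERIV_ident] deriv] DERIV_cmult[OF deriv]]]) simp
      moreover have "?k * ((1 - 1 / \<xi>) * ?u powr (1 - 1 / \<xi> - 1) * (\<xi> / \<sigma>)) =
          (?k * (1 - 1 / \<xi>) * (\<xi> / \<sigma>)) * ?u powr (- 1 / \<xi>)"
        by simp
      moreover have "?k * (1 - 1 / \<xi>) * (\<xi> / \<sigma>) = - 1"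
        using assms xi by (simp add: divide_simps)
      ultimately show ?thesis using xi by simp
    qed
  qed (use assms in auto)
  also have "0 - F 0 = \<sigma> / (1 - \<xi>)" by (simp add: F_def)
  finally show ?thesis .
qed

section \<open>Wasserstein distance from a Dirac mass\<close>

lemma sets_gpd[simp, measurable_cong]: "sets (gpd \<theta>) = sets borel"
  by (simp add: gpd_def split_beta)

lemma prob_space_gpd:
  assumes "\<theta> \<in> gpd_params"
  shows "prob_space (gpd \<theta>)"
  using assms gpd_total[of "fst \<theta>" "snd \<theta>"]
  by (intro prob_spaceI) (auto simp: gpd_def split_beta emeasure_density gpd_params_def)

text \<open>Under any coupling the first coordinate is almost surely \<open>a\<close>, so the cost
  depends on the second marginal alone and the infimum is over a constant.\<close>

lemma wasserstein1_return:
  assumes "prob_space \<nu>" and [measurable_cong]: "sets \<nu> = sets borel"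
  shows "wasserstein1 (return borel a) \<nu> = (\<integral>\<^sup>+y. ennreal \<bar>a - y\<bar> \<partial>\<nu>)"
proof -
  interpret prob_space \<nu> by fact
  have "(\<integral>\<^sup>+z. ennreal \<bar>fst z - snd z\<bar> \<partial>Q) = (\<integral>\<^sup>+y. ennreal \<bar>a - y\<bar> \<partial>\<nu>)"
    if "Q \<in> couplings (return borel a) \<nu>" for Q
  proof -
    have Q[measurable_cong]: "sets Q = sets (borel \<Otimes>\<^sub>M borel)" and
      dist: "distr Q borel fst = return borel a" "distr Q borel snd = \<nu>"
      using that by (auto simp: couplings_def)
    have "AE x in distr Q borel fst. x = a" unfolding dist by (subst AE_return) auto
    then have "AE z in Q. fst z = a" by (subst (asm) AE_distr_iff) auto
    then have "(\<integral>\<^sup>+z. ennreal \<bar>fst z - snd z\<bar> \<partial>Q) = (\<integral>\<^sup>+z. ennreal \<bar>a - snd z\<bar> \<partial>Q)"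
      by (intro nn_integral_cong_AE) auto
    also have "\<dots> = (\<integral>\<^sup>+y. ennreal \<bar>a - y\<bar> \<partial>distr Q borel snd)"
      by (subst nn_integral_distr) auto
    finally show ?thesis by (simp add: dist)
  qed
  \<comment> \<open>A coupling must exist, since an infimum over the empty set would be
    \<top>.\<close>
  moreover have "distr \<nu> (borel \<Otimes>\<^sub>M borel) (\<lambda>y. (a, y)) \<in> couplings (return borel a) \<nu>"
    using assms(2) by (auto simp: couplings_def distr_distr comp_def intro!: prob_space_distr distr_id2)
  ultimately show ?thesis
    unfolding wasserstein1_def by (metis (mono_tags, lifting) INF_eq_const empty_iff)
qed

lemma wasserstein1_gpd:
  assumes "(\<sigma>, \<xi>) \<in> gpd_params"
  shows "wasserstein1 (return borel 0) (gpd (\<sigma>, \<xi>)) = ennreal (\<sigma> / (1 - \<xi>))"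
proof -
  have "wasserstein1 (return borel 0) (gpd (\<sigma>, \<xi>)) = (\<integral>\<^sup>+y. ennreal \<bar>y\<bar> \<partial>gpd (\<sigma>, \<xi>))"
    using prob_space_gpd[OF assms] by (simp add: wasserstein1_return)
  also have "\<dots> = ennreal (\<sigma> / (1 - \<xi>))"
    using gpd_mean[of \<sigma> \<xi>] assms by (simp add: gpd_def nn_integral_density gpd_params_def)
  finally show ?thesis .
qed

section \<open>Level curves and their arc length\<close>

definition level_param :: "real \<Rightarrow> real \<Rightarrow> real \<times> real" where
  "level_param w \<xi> = (w * (1 - \<xi>), \<xi>)"

text \<open>The level curve is a straight segment traversed at constant speed
  \<open>sqrt (1 + w\<^sup>2)\<close>, so the results on similarities apply to it.\<close>

lemma dist_level_param: "dist (level_param w x) (level_param w y) = sqrt (1 + w\<^sup>2) * \<bar>x - y\<bar>"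
proof -
  have "dist (w * (1 - x)) (w * (1 - y)) = \<bar>w\<bar> * \<bar>x - y\<bar>"
    by (simp only: dist_real_def right_diff_distrib[symmetric] abs_mult) (simp add: abs_minus_commute)
  then have "(dist (w * (1 - x)) (w * (1 - y)))\<^sup>2 + (dist x y)\<^sup>2 = (1 + w\<^sup>2) * \<bar>x - y\<bar>\<^sup>2"
    by (simp only: power_mult_distrib power2_abs dist_real_def) (simp add: algebra_simps)
  then show ?thesis
    by (simp add: level_param_def dist_Pair_Pair real_sqrt_mult)
qed

lemma level_param_measurable[measurable]:
  "(\<lambda>(w, x). level_param w x) \<in> borel_measurable (borel \<Otimes>\<^sub>M borel)"
  "level_param w \<in> borel_measurable borel"
  unfolding level_param_def[abs_def] by measurable

lemma level_param_in_gpd_params: "level_param w x \<in> gpd_params \<longleftrightarrow> 0 < w \<and> x \<in> {0..<1}"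
  by (auto simp: level_param_def gpd_params_def zero_less_mult_iff)

lemma gpd_params_sets[measurable]: "gpd_params \<in> sets borel"
  unfolding gpd_params_def by (simp add: borel_prod[symmetric])

lemma gpd_level_set:
  assumes "w > 0"
  shows "{\<theta> \<in> gpd_params. wasserstein1 (return borel 0) (gpd \<theta>) = ennreal w} = level_param w ` {0..<1}"
    (is "?S = _")
proof (intro set_eqI iffI)
  fix \<theta> assume "\<theta> \<in> ?S"
  moreover obtain s x where \<theta>: "\<theta> = (s, x)" by (cases \<theta>)
  ultimately have *: "s > 0" "0 \<le> x" "x < 1" "ennreal (s / (1 - x)) = ennreal w"
    by (auto simp: wasserstein1_gpd) (auto simp: gpd_params_def)
  \<comment> \<open>\<open>ennreal\<close> sends all nonpositive reals to 0; positivity of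
    \<open>w\<close> lets the equality descend to the reals.\<close>
  then have "s / (1 - x) = w" using assms by simp
  with * show "\<theta> \<in> level_param w ` {0..<1}"
    by (intro image_eqI[of _ _ x]) (auto simp: level_param_def \<theta>)
next
  fix \<theta> assume "\<theta> \<in> level_param w ` {0..<1}"
  then obtain x where x: "\<theta> = level_param w x" "x \<in> {0..<1}" by auto
  with assms have "\<theta> \<in> gpd_params" by (simp add: level_param_in_gpd_params)
  with x show "\<theta> \<in> ?S" by (auto simp: level_param_def wasserstein1_gpd)
qed

text \<open>Pulling \<open>A\<close> back to the parameter interval reduces arc length to Lebesgue
  measure; \<open>A = UNIV\<close> gives the length of the whole curve.\<close>

lemma arc_length_level_set:
  assumes "A \<in> sets borel"
  shows "arc_length (A \<inter> level_param w ` {0..<1}) =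
    ennreal (sqrt (1 + w\<^sup>2)) * emeasure lborel ({0..<1} \<inter> level_param w -` A)"
proof -
  have "A \<inter> level_param w ` {0..<1} = level_param w ` ({0..<1} \<inter> level_param w -` A)" by auto
  moreover have "level_param w -` A \<in> sets borel"
    using measurable_sets[OF level_param_measurable(2) assms] by simp
  moreover have "sqrt (1 + w\<^sup>2) > 0" by (simp add: add_pos_nonneg)
  moreover have "{0..<1} \<inter> level_param w -` A \<subseteq> {0..1}" by auto
  ultimately show ?thesis
    using arc_length_similarity[OF dist_level_param, of w "{0..<1} \<inter> level_param w -` A" 0 1] by simp
qed

section \<open>The uniform distributions on the level curves as a kernel\<close>

text \<open>A kernel must give a probability measure on the parameter set for every real
  \<open>w\<close>, but \<open>level_param w\<close> leaves that set when \<open>w \<le> 0\<close>.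
  There the arbitrary value 1 is substituted, on a null set of \<open>trunc_exp\<close>.\<close>

definition gpd_kernel :: "real \<Rightarrow> (real \<times> real) measure" where
  "gpd_kernel w = distr (restrict_space lborel {0..<1}) (restrict_space borel gpd_params)
     (level_param (if 0 < w then w else 1))"

lemma gpd_kernel_measurable[measurable]:
  "gpd_kernel \<in> borel \<rightarrow>\<^sub>M prob_algebra (restrict_space borel gpd_params)"
  unfolding gpd_kernel_def[abs_def]
proof (rule measurable_distr_prob_space2)
  have "prob_space (restrict_space lborel {0..<1::real})"
    by (intro prob_spaceI) (simp add: emeasure_restrict_space space_restrict_space)
  then show "(\<lambda>w. restrict_space lborel {0..<1}) \<in> borel \<rightarrow>\<^sub>M prob_algebra (restrict_space lborel {0..<1::real})"
    by (intro measurable_const) (simp add: space_prob_algebra)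
  have [measurable]: "(\<lambda>x. x) \<in> restrict_space lborel {0..<1::real} \<rightarrow>\<^sub>M borel"
    by (intro measurable_restrict_space1) simp
  have "(\<lambda>p. level_param (if 0 < fst p then fst p else 1) (snd p)) \<in>
     borel \<Otimes>\<^sub>M restrict_space lborel {0..<1} \<rightarrow>\<^sub>M restrict_space borel gpd_params"
  proof (rule measurable_restrict_space2)
    show "(\<lambda>p. level_param (if 0 < fst p then fst p else 1) (snd p)) \<in>
     borel \<Otimes>\<^sub>M restrict_space lborel {0..<1} \<rightarrow>\<^sub>M borel"
      unfolding level_param_def by measurable
  qed (auto simp: space_pair_measure level_param_in_gpd_params)
  then show "(\<lambda>(w, x). level_param (if 0 < w then w else 1) x) \<in>
     borel \<Otimes>\<^sub>M restrict_space lborel {0..<1} \<rightarrow>\<^sub>M restrict_space borel gpd_params"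
    by (simp add: split_beta')
qed

lemma sets_gpd_kernel: "sets (gpd_kernel w) = sets (restrict_space borel gpd_params)"
  by (simp add: gpd_kernel_def)

lemma sets_restrict_gpd_params:
  "A \<in> sets (restrict_space borel gpd_params) \<longleftrightarrow> A \<in> sets borel \<and> A \<subseteq> gpd_params"
  by (subst sets_restrict_space_iff) auto

lemma emeasure_gpd_kernel:
  assumes "w > 0" "A \<in> sets borel" "A \<subseteq> gpd_params"
  shows "emeasure (gpd_kernel w) A = emeasure lborel ({0..<1} \<inter> level_param w -` A)"
proof -
  have "level_param w \<in> restrict_space lborel {0..<1} \<rightarrow>\<^sub>M restrict_space borel gpd_params"
    by (rule measurable_restrict_space2)
       (use assms in \<open>auto simp: level_param_in_gpd_params intro!: measurable_restrict_space1\<close>)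
  then show ?thesis
    using assms by (simp add: gpd_kernel_def emeasure_distr sets_restrict_gpd_params
        emeasure_restrict_space Int_commute)
qed

text \<open>The constant speed cancels in the quotient, so Lebesgue measure on the parameter
  interval is normalized arc length.\<close>

lemma emeasure_gpd_kernel_arc_length:
  assumes "w > 0" "A \<in> sets borel" "A \<subseteq> gpd_params"
  shows "emeasure (gpd_kernel w) A =
    arc_length (A \<inter> level_param w ` {0..<1}) / arc_length (level_param w ` {0..<1})"
proof -
  have pos: "sqrt (1 + w\<^sup>2) > 0" by (simp add: add_pos_nonneg)
  have "arc_length (level_param w ` {0..<1}) = ennreal (sqrt (1 + w\<^sup>2))"
    using arc_length_level_set[of UNIV w] by simp
  with pos show ?thesis
    by (simp add: emeasure_gpd_kernel[OF assms] arc_length_level_set[OF assms(2)] ennreal_mult_divide_eq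
       mult.commute[of "ennreal _"])
qed

lemma uniform_on_curve_gpd_kernel:
  assumes "w > 0"
  shows "uniform_on_curve (level_param w ` {0..<1}) (gpd_kernel w)"
proof -
  have "prob_space (gpd_kernel w)"
    using measurable_space[OF gpd_kernel_measurable, of w] by (simp add: space_prob_algebra)
  moreover have "arc_length (level_param w ` {0..<1}) = ennreal (sqrt (1 + w\<^sup>2))"
    using arc_length_level_set[of UNIV w] by simp
  moreover have "sqrt (1 + w\<^sup>2) > 0" by (simp add: add_pos_nonneg)
  ultimately show ?thesis
    using emeasure_gpd_kernel_arc_length[OF assms]
    by (auto simp: uniform_on_curve_def sets_gpd_kernel sets_restrict_gpd_params)
qed

section \<open>The exponential law on an unbounded range\<close>

lemma trunc_exp_density_top:
  "trunc_exp_density \<eta> \<top> w = (if 0 < w then \<eta> * exp (- \<eta> * w) else 0)"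
  by (simp add: trunc_exp_density_def ennreal_less_top)

lemma trunc_exp_density_measurable[measurable]: "trunc_exp_density \<eta> \<top> \<in> borel_measurable borel"
  unfolding trunc_exp_density_top[abs_def] by measurable

lemma sets_trunc_exp[simp, measurable_cong]: "sets (trunc_exp \<eta> c) = sets borel"
  by (simp add: trunc_exp_def)

lemma AE_trunc_exp_pos: "AE w in trunc_exp \<eta> \<top>. 0 < w"
  unfolding trunc_exp_def by (subst AE_density) (auto simp: trunc_exp_density_top)

lemma prob_space_trunc_exp:
  assumes "\<eta> > 0"
  shows "prob_space (trunc_exp \<eta> \<top>)"
proof -
  have "trunc_exp \<eta> \<top> = density lborel (exponential_density \<eta>)"
    unfolding trunc_exp_def
  proof (rule density_cong)
    show "AE w in lborel. ennreal (trunc_exp_density \<eta> \<top> w) = ennreal (exponential_density \<eta> w)"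
      \<comment> \<open>The library's exponential density is positive at 0 and
        \<open>trunc_exp_density\<close> is 0 there; elsewhere they agree.\<close>
      using AE_lborel_singleton[of 0]
      by eventually_elim (auto simp: trunc_exp_density_top exponential_density_def mult.commute)
  qed measurable
  then show ?thesis using prob_space_exponential_density[OF assms] by simp
qed

section \<open>The joint density and its disintegration along level curves\<close>

definition gpd_prior :: "real \<Rightarrow> (real \<times> real) measure" where
  "gpd_prior \<eta> = density (restrict_space lborel gpd_params)
     (\<lambda>(\<sigma>, \<xi>). ennreal (\<eta> / (1 - \<xi>) * exp (- \<eta> * (\<sigma> / (1 - \<xi>)))))"

lemma sets_gpd_prior: "sets (gpd_prior \<eta>) = sets (restrict_space borel gpd_params)"
  by (simp add: gpd_prior_def cong: sets_restrict_space_cong)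

text \<open>This is the change of variables from \<open>(\<sigma>, \<xi>)\<close> to
  \<open>(w, \<xi>)\<close>, done one coordinate at a time: an affine substitution at fixed \<xi>,
  then Tonelli to bring the integral over \<open>w\<close> outside.\<close>

lemma emeasure_gpd_prior:
  assumes "\<eta> > 0" and A: "A \<in> sets (restrict_space borel gpd_params)"
  shows "emeasure (gpd_prior \<eta>) A = (\<integral>\<^sup>+w. emeasure (gpd_kernel w) A \<partial>trunc_exp \<eta> \<top>)"
proof -
  define h where "h = (\<lambda>(\<sigma>, \<xi>). ennreal (\<eta> / (1 - \<xi>) * exp (- \<eta> * (\<sigma> / (1 - \<xi>)))))"
  have A': "A \<in> sets borel" "A \<subseteq> gpd_params" using A by (simp_all add: sets_restrict_gpd_params)
  then have [measurable]: "A \<in> sets (borel \<Otimes>\<^sub>M borel)" by (subst borel_prod)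
  have h[measurable]: "h \<in> borel_measurable (borel \<Otimes>\<^sub>M borel)" unfolding h_def by measurable
  then have h_borel: "h \<in> borel_measurable borel" by (simp add: borel_prod)
  \<comment> \<open>The joint density of \<open>(w, \<xi>)\<close>, an exponential times a uniform
    one, cut down to the preimage of \<open>A\<close>.\<close>
  define G where "G w x = ennreal (trunc_exp_density \<eta> \<top> w) * (indicator {0..<1} x * indicator A (level_param w x))" for w x
  have [measurable]: "(\<lambda>(w, x). G w x) \<in> borel_measurable (borel \<Otimes>\<^sub>M borel)"
    unfolding G_def level_param_def by measurable
  have inner: "(\<integral>\<^sup>+s. h (s, x) * indicator A (s, x) \<partial>lborel) = (\<integral>\<^sup>+w. G w x \<partial>lborel)" for x
  proof (cases "x \<in> {0..<1}")
    case True
    \<comment> \<open>Substituting \<open>s = (1 - x) * w\<close> yields the factor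
      \<open>1 - x\<close>, which cancels the \<open>1 / (1 - \<xi>)\<close> in
      \<open>h\<close>.\<close>
    have "(\<integral>\<^sup>+s. h (s, x) * indicator A (s, x) \<partial>lborel) =
      ennreal \<bar>1 - x\<bar> * (\<integral>\<^sup>+w. h (0 + (1 - x) * w, x) * indicator A (0 + (1 - x) * w, x) \<partial>lborel)"
      using True by (intro nn_integral_real_affine) auto
    also have "\<dots> = (\<integral>\<^sup>+w. ennreal \<bar>1 - x\<bar> * (h (0 + (1 - x) * w, x) * indicator A (0 + (1 - x) * w, x)) \<partial>lborel)"
      by (intro nn_integral_cmult[symmetric]) simp
    also have "\<dots> = (\<integral>\<^sup>+w. G w x \<partial>lborel)"
    proof (rule nn_integral_cong)
      fix w
      show "ennreal \<bar>1 - x\<bar> * (h (0 + (1 - x) * w, x) * indicator A (0 + (1 - x) * w, x)) = G w x"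
      proof (cases "level_param w x \<in> A")
        case False
        then show ?thesis by (simp add: G_def level_param_def mult.commute)
      next
        case lA: True
        \<comment> \<open>As \<open>A\<close> lies in the parameter set, only positive
          \<open>w\<close> contribute, where \<open>trunc_exp_density\<close> has its exponential
          form.\<close>
        then have "w > 0" using A'(2) level_param_in_gpd_params by blast
        moreover have "ennreal \<bar>1 - x\<bar> * h ((1 - x) * w, x) = ennreal (\<eta> * exp (- \<eta> * w))"
          using True assms by (simp add: h_def flip: ennreal_mult)
        ultimately show ?thesis using lA True
          by (simp add: G_def level_param_def mult.commute trunc_exp_density_top)
      qed
    qed
    finally show ?thesis .
  next
    case False
    then have "(s, x) \<notin> A" for s using A'(2) by (auto simp: gpd_params_def)
    then show ?thesis using False by (simp add: G_def)
  qed
  have "emeasure (gpd_prior \<eta>) A = (\<integral>\<^sup>+\<theta>. h \<theta> * indicator A \<theta> \<partial>restrict_space lborel gpd_params)"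
    unfolding gpd_prior_def h_def[symmetric] using A h_borel
    by (intro emeasure_density measurable_restrict_space1) (auto cong: sets_restrict_space_cong)
  also have "\<dots> = (\<integral>\<^sup>+\<theta>. h \<theta> * indicator A \<theta> * indicator gpd_params \<theta> \<partial>lborel)"
    by (subst nn_integral_restrict_space) auto
  also have "\<dots> = (\<integral>\<^sup>+\<theta>. h \<theta> * indicator A \<theta> \<partial>(lborel \<Otimes>\<^sub>M lborel))"
    using A'(2) by (subst lborel_prod) (intro nn_integral_cong, auto split: split_indicator)
  \<comment> \<open>Scale is integrated first, so that \<open>inner\<close> applies at each fixed
    shape.\<close>
  also have "\<dots> = (\<integral>\<^sup>+x. \<integral>\<^sup>+s. h (s, x) * indicator A (s, x) \<partial>lborel \<partial>lborel)"
    by (intro lborel_pair.nn_integral_snd[symmetric]) measurable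
  also have "\<dots> = (\<integral>\<^sup>+x. \<integral>\<^sup>+w. G w x \<partial>lborel \<partial>lborel)" by (simp add: inner)
  also have "\<dots> = (\<integral>\<^sup>+w. \<integral>\<^sup>+x. G w x \<partial>lborel \<partial>lborel)"
    by (intro lborel_pair.Fubini') measurable
  also have "\<dots> = (\<integral>\<^sup>+w. ennreal (trunc_exp_density \<eta> \<top> w) * emeasure (gpd_kernel w) A \<partial>lborel)"
  proof (rule nn_integral_cong)
    fix w
    have [measurable]: "level_param w -` A \<in> sets borel"
      using measurable_sets[OF level_param_measurable(2) A'(1)] by simp
    have "(\<integral>\<^sup>+x. G w x \<partial>lborel) = ennreal (trunc_exp_density \<eta> \<top> w) *
       (\<integral>\<^sup>+x. indicator ({0..<1} \<inter> level_param w -` A) x \<partial>lborel)"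
      unfolding G_def by (subst nn_integral_cmult[symmetric]) (auto intro!: nn_integral_cong split: split_indicator)
    also have "\<dots> = ennreal (trunc_exp_density \<eta> \<top> w) * emeasure lborel ({0..<1} \<inter> level_param w -` A)"
      by simp
    finally show "(\<integral>\<^sup>+x. G w x \<partial>lborel) = ennreal (trunc_exp_density \<eta> \<top> w) * emeasure (gpd_kernel w) A"
      using emeasure_gpd_kernel[OF _ A'] by (cases "w > 0") (auto simp: trunc_exp_density_top)
  qed
  also have "\<dots> = (\<integral>\<^sup>+w. emeasure (gpd_kernel w) A \<partial>trunc_exp \<eta> \<top>)"
    unfolding trunc_exp_def using measurable_emeasure_kernel[OF measurable_prob_algebraD[OF gpd_kernel_measurable] A]
    by (intro nn_integral_density[symmetric]) auto
  finally show ?thesis .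
qed

text \<open>At \<open>\<xi> = 0\<close> the distance is the scale itself, which is unbounded; thus
  the cutoff of the exponential law is infinite.\<close>

lemma SUP_wasserstein1_gpd: "(SUP \<theta>\<in>gpd_params. wasserstein1 (return borel 0) (gpd \<theta>)) = \<top>"
proof -
  have "ennreal (real (Suc n)) \<le> (SUP \<theta>\<in>gpd_params. wasserstein1 (return borel 0) (gpd \<theta>))" for n
    using wasserstein1_gpd[of "real (Suc n)" 0]
    by (intro SUP_upper2[of "(real (Suc n), 0)"]) (auto simp: gpd_params_def)
  moreover have "(of_nat n :: ennreal) \<le> ennreal (real (Suc n))" for n
    by (simp only: ennreal_of_nat_eq_real_of_nat) (simp add: ennreal_leI)
  ultimately have "(SUP n. of_nat n :: ennreal) \<le> (SUP \<theta>\<in>gpd_params. wasserstein1 (return borel 0) (gpd \<theta>))"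
    by (intro SUP_least) (rule order_trans)
  then show ?thesis by (simp add: ennreal_SUP_of_nat_eq_top top_unique)
qed

section \<open>Characterization of the prior\<close>

text \<open>For uniqueness, uniformity on level curves fixes the kernel for almost every
  \<open>w\<close>, and the disintegration then fixes \<open>P\<close>. For existence,
  \<open>gpd_kernel\<close> is the required conditional distribution.\<close>

theorem proposition7:
  fixes \<eta> :: real and P :: "(real \<times> real) measure"
  assumes "\<eta> > 0"
  shows "is_WCP1_prior gpd_params (return borel 0) gpd \<eta> P \<longleftrightarrow>
    P = density (restrict_space lborel gpd_params)
          (\<lambda>(\<sigma>, \<xi>). ennreal (\<eta> / (1 - \<xi>) * exp (- \<eta> * (\<sigma> / (1 - \<xi>)))))"
  unfolding gpd_prior_def[symmetric]
proof
  assume *: "is_WCP1_prior gpd_params (return borel 0) gpd \<eta> P"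
  show "P = gpd_prior \<eta>"
  proof (rule measure_eqI)
    show sets: "sets P = sets (gpd_prior \<eta>)"
      using * by (simp add: is_WCP1_prior_def Let_def sets_gpd_prior)
    fix A assume A: "A \<in> sets P"
    have A': "A \<in> sets (restrict_space borel gpd_params)" using A sets sets_gpd_prior by simp
    obtain K where K: "K \<in> borel \<rightarrow>\<^sub>M prob_algebra (restrict_space borel gpd_params)"
      and uniform: "AE w in trunc_exp \<eta> \<top>. uniform_on_curve
         {\<theta> \<in> gpd_params. wasserstein1 (return borel 0) (gpd \<theta>) = ennreal w} (K w)"
      and disint: "\<And>B. B \<in> sets borel \<Longrightarrow> emeasure P {\<theta> \<in> A. enn2real (wasserstein1 (return borel 0) (gpd \<theta>)) \<in> B} =
         (\<integral>\<^sup>+w. emeasure (K w) A * indicator B w \<partial>trunc_exp \<eta> \<top>)"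
      using * A unfolding is_WCP1_prior_def Let_def SUP_wasserstein1_gpd by blast
    \<comment> \<open>With \<open>B = UNIV\<close> the condition on the distance disappears.\<close>
    have "emeasure P A = (\<integral>\<^sup>+w. emeasure (K w) A \<partial>trunc_exp \<eta> \<top>)"
      using disint[of UNIV] by simp
    also have "\<dots> = (\<integral>\<^sup>+w. emeasure (gpd_kernel w) A \<partial>trunc_exp \<eta> \<top>)"
    proof (rule nn_integral_cong_AE)
      \<comment> \<open>For almost every \<open>w\<close> both sides are the same quotient of arc
        lengths.\<close>
      show "AE w in trunc_exp \<eta> \<top>. emeasure (K w) A = emeasure (gpd_kernel w) A"
        using uniform AE_trunc_exp_pos
      proof eventually_elim
        case (elim w)
        have "sets (K w) = sets (restrict_space borel gpd_params)"
          by (rule sets_kernel[OF measurable_prob_algebraD[OF K]]) simp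
        with elim A' show ?case
          by (simp add: uniform_on_curve_def gpd_level_set emeasure_gpd_kernel_arc_length sets_restrict_gpd_params)
      qed
    qed
    finally show "emeasure P A = emeasure (gpd_prior \<eta>) A"
      by (simp add: emeasure_gpd_prior[OF assms A'])
  qed
next
  define W where "W = (\<lambda>\<theta>. enn2real (wasserstein1 (return borel 0) (gpd \<theta>)))"
  assume P: "P = gpd_prior \<eta>"
  have sets_P: "sets P = sets (restrict_space borel gpd_params)"
    by (simp add: P sets_gpd_prior)
  have space_P: "space P = gpd_params"
    using sets_eq_imp_space_eq[OF sets_P] by (simp add: space_restrict_space)
  have W_eq: "W \<theta> = fst \<theta> / (1 - snd \<theta>)" if "\<theta> \<in> gpd_params" for \<theta>
    using that by (cases \<theta>) (simp add: W_def wasserstein1_gpd, simp add: gpd_params_def)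
  have W_level: "W (level_param w x) = w" if "w > 0" "x \<in> {0..<1}" for w x
    using that by (subst W_eq) (auto simp: level_param_in_gpd_params, simp add: level_param_def)
  have W_meas[measurable]: "W \<in> borel_measurable P"
  proof (subst measurable_cong[OF W_eq])
    have "(\<lambda>\<theta>. fst \<theta> / (1 - snd \<theta>)) \<in> borel_measurable (borel \<Otimes>\<^sub>M borel :: (real \<times> real) measure)"
      by measurable
    then have "(\<lambda>\<theta>. fst \<theta> / (1 - snd \<theta>)) \<in> borel_measurable (restrict_space borel gpd_params :: (real \<times> real) measure)"
      by (intro measurable_restrict_space1) (simp add: borel_prod)
    then show "(\<lambda>\<theta>. fst \<theta> / (1 - snd \<theta>)) \<in> borel_measurable P"
      using measurable_cong_sets[OF sets_P refl] by blast
  qed (simp add: space_P)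
  have disint: "emeasure P {\<theta> \<in> A. W \<theta> \<in> B} =
      (\<integral>\<^sup>+w. emeasure (gpd_kernel w) A * indicator B w \<partial>trunc_exp \<eta> \<top>)"
    if A: "A \<in> sets P" and B: "B \<in> sets borel" for A B
  proof -
    have "{\<theta> \<in> A. W \<theta> \<in> B} = A \<inter> (W -` B \<inter> space P)"
      using sets.sets_into_space[OF A] by auto
    then have AB: "{\<theta> \<in> A. W \<theta> \<in> B} \<in> sets P" using A B by simp
    have "emeasure P {\<theta> \<in> A. W \<theta> \<in> B} = (\<integral>\<^sup>+w. emeasure (gpd_kernel w) {\<theta> \<in> A. W \<theta> \<in> B} \<partial>trunc_exp \<eta> \<top>)"
      using emeasure_gpd_prior[OF assms] AB by (simp add: P sets_gpd_prior)
    also have "\<dots> = (\<integral>\<^sup>+w. emeasure (gpd_kernel w) A * indicator B w \<partial>trunc_exp \<eta> \<top>)"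
    proof (rule nn_integral_cong_AE)
      show "AE w in trunc_exp \<eta> \<top>. emeasure (gpd_kernel w) {\<theta> \<in> A. W \<theta> \<in> B} =
          emeasure (gpd_kernel w) A * indicator B w"
        using AE_trunc_exp_pos
      proof eventually_elim
        case (elim w)
        \<comment> \<open>The distance is constantly \<open>w\<close> along the curve, so the
          condition \<open>W \<theta> \<in> B\<close> keeps all of it or nothing.\<close>
        have "{0..<1} \<inter> level_param w -` {\<theta> \<in> A. W \<theta> \<in> B} =
            (if w \<in> B then {0..<1} \<inter> level_param w -` A else {})"
          using W_level[OF elim] by (auto simp del: split_paired_All) metis
        with elim A AB show ?case
          by (simp add: emeasure_gpd_kernel sets_P sets_restrict_gpd_params)
      qed
    qed
    finally show ?thesis .
  qed
  have kernel_space: "emeasure (gpd_kernel w) gpd_params = 1" for w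
  proof -
    have "prob_space (gpd_kernel w)"
      using measurable_space[OF gpd_kernel_measurable, of w] by (simp add: space_prob_algebra)
    moreover have "space (gpd_kernel w) = gpd_params"
      by (simp add: gpd_kernel_def space_restrict_space)
    ultimately show ?thesis using prob_space.emeasure_space_1 by metis
  qed
  interpret T: prob_space "trunc_exp \<eta> \<top>" using assms by (rule prob_space_trunc_exp)
  have params: "gpd_params \<in> sets P" using sets.top[of P] by (simp add: space_P)
  \<comment> \<open>Taking \<open>A = gpd_params\<close> in \<open>disint\<close>, where each kernel
    has mass 1, leaves the law of the distance.\<close>
  have distr: "distr P borel W = trunc_exp \<eta> \<top>"
  proof (rule measure_eqI)
    fix B assume "B \<in> sets (distr P borel W)"
    then have B: "B \<in> sets borel" by simp
    have "W -` B \<inter> space P = {\<theta> \<in> gpd_params. W \<theta> \<in> B}" by (auto simp: space_P)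
    then show "emeasure (distr P borel W) B = emeasure (trunc_exp \<eta> \<top>) B"
      using B disint[OF params B] by (simp add: emeasure_distr kernel_space)
  qed simp
  \<comment> \<open>Total mass is preserved under \<open>distr\<close>, so it is read off from the
    exponential law.\<close>
  have "prob_space P"
    by (rule prob_space_distrD[OF W_meas]) (simp add: distr T.prob_space_axioms)
  moreover have "AE w in trunc_exp \<eta> \<top>. uniform_on_curve
      {\<theta> \<in> gpd_params. wasserstein1 (return borel 0) (gpd \<theta>) = ennreal w} (gpd_kernel w)"
    using AE_trunc_exp_pos by eventually_elim (simp add: gpd_level_set uniform_on_curve_gpd_kernel)
  ultimately show "is_WCP1_prior gpd_params (return borel 0) gpd \<eta> P"
    unfolding is_WCP1_prior_def Let_def SUP_wasserstein1_gpd W_def[symmetric]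
    using sets_P W_meas distr disint gpd_kernel_measurable by blast
qed

end
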